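(* Let $\{E_t : t\ge 0\}$ be a semi-group of linear operators on the normed function space $(\mathcal{F},\|\cdot\|_{\mathcal{F}})$ with extended generator $B$. For any integer $M\ge 1$, any $f\in\mathcal{D}(B^{M+1})$ and any $t\ge 0$, the functions $u_t(x)=E_tf(x)$ and $$\hat u_t(x)=\sum_{m=0}^{M}\frac{t^m}{m!}B^mf(x)$$ satisfy $$|u_t(x)-\hat u_t(x)|=\left|\int_0^t\int_0^{t_1}\cdots\int_0^{t_M}B^{M+1}u_{t_{M+1}}(x)\,dt_{M+1}\cdots dt_1\right|\le\frac{t^{M+1}}{(M+1)!}\sup_{0\le s\le t}\left|B^{M+1}u_s(x)\right|.$$
   Context: $\mathcal{F}$ is a space of real-valued functions on a set $\mathcal{X}\subseteq\mathbb{R}^d$, equipped with a function norm $\|\cdot\|_{\mathcal{F}}$. A family of linear operators $E_t:\mathcal{F}\to\mathcal{F}$, $t\ge 0$, is a semi-group if $E_0f=f$ and $E_{s+t}f=E_sE_tf$ for all $s,t\ge 0$. (Leading example: $E_tf(x)=\mathbb{E}[f(x_t)\mid x_0=x]$ for a time-homogeneous Markov process $x_t$ with values in $\mathcal{X}$.) Extended generator: $\mathcal{D}(B)$ is the set of functions $f\in\mathcal{F}$ for which there exists $g\in\mathcal{F}$ such that, for each $t\ge 0$, $$E_tf=f+\int_0^tE_sg\,ds,\qquad \big\|E_t|g|\big\|_{\mathcal{F}}<\infty ,$$ and one writes $Bf:=g$. Domains of powers are defined recursively by $\mathcal{D}(B^m)=\{f\in\mathcal{D}(B^{m-1}): B^{m-1}f\in\mathcal{D}(B)\}$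 for $m=2,3,\dots$.
   Formalization: F is assumed closed under absolute values, so that E_t|g| is defined, and g in the definition of the extended generator is assumed uniquely determined by f; without uniqueness (e.g. E_0=id, E_t=0 for t>0) Bf is not well defined. *)

theory Defs
  imports "HOL-Analysis.Analysis"
begin

text \<open>
  A real function on \<open>X\<close> is represented by the total function that agrees with it on \<open>X\<close> and
  is zero off \<open>X\<close>, so that equality of representatives is equality on \<open>X\<close>.
  The norm takes values in \<^typ>\<open>ennreal\<close> so that finiteness of a norm can be written down; on a
  normed space \<open>F\<close> it is finite. Closure under absolute values is what makes \<open>E\<^sub>t \<bar>g\<bar>\<close>
  meaningful for \<open>g \<in> F\<close> and operators \<open>E\<^sub>t\<close> defined on \<open>F\<close> only.
\<close>

locale normed_function_space =
  fixes X :: "(real^'d) set"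
    and F :: "(real^'d \<Rightarrow> real) set"
    and N :: "(real^'d \<Rightarrow> real) \<Rightarrow> ennreal"
  assumes zero_off: "f \<in> F \<Longrightarrow> x \<notin> X \<Longrightarrow> f x = 0"
    and zero_mem: "(\<lambda>x. 0) \<in> F"
    and add_mem: "f \<in> F \<Longrightarrow> g \<in> F \<Longrightarrow> (\<lambda>x. f x + g x) \<in> F"
    and scale_mem: "f \<in> F \<Longrightarrow> (\<lambda>x. a * f x) \<in> F"
    and abs_mem: "f \<in> F \<Longrightarrow> (\<lambda>x. \<bar>f x\<bar>) \<in> F"
    and norm_finite: "f \<in> F \<Longrightarrow> N f < \<infinity>"
    and norm_eq_0: "f \<in> F \<Longrightarrow> N f = 0 \<longleftrightarrow> f = (\<lambda>x. 0)"
    and norm_triangle: "f \<in> F \<Longrightarrow> g \<in> F \<Longrightarrow> N (\<lambda>x. f x + g x) \<le> N f + N g"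
    and norm_scale: "f \<in> F \<Longrightarrow> N (\<lambda>x. a * f x) = ennreal \<bar>a\<bar> * N f"

locale operator_semigroup = normed_function_space X F N
  for X :: "(real^'d) set" and F N +
  fixes E :: "real \<Rightarrow> (real^'d \<Rightarrow> real) \<Rightarrow> (real^'d \<Rightarrow> real)"
  assumes E_mem: "0 \<le> t \<Longrightarrow> f \<in> F \<Longrightarrow> E t f \<in> F"
    and E_add: "0 \<le> t \<Longrightarrow> f \<in> F \<Longrightarrow> g \<in> F \<Longrightarrow>
      E t (\<lambda>x. f x + g x) = (\<lambda>x. E t f x + E t g x)"
    and E_scale: "0 \<le> t \<Longrightarrow> f \<in> F \<Longrightarrow> E t (\<lambda>x. a * f x) = (\<lambda>x. a * E t f x)"
    and E_zero: "f \<in> F \<Longrightarrow> E 0 f = f"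
    and E_plus: "0 \<le> s \<Longrightarrow> 0 \<le> t \<Longrightarrow> f \<in> F \<Longrightarrow> E (s + t) f = E s (E t f)"

text \<open>
  \<open>gen_pair X F N E f g\<close>: \<open>f\<close> is in the domain of the extended generator, witnessed by \<open>g\<close>.
  The integral equation is pointwise on \<open>X\<close> and the integral is a Lebesgue integral, whose
  existence is required explicitly because \<^const>\<open>integral\<close> is total.
\<close>

definition gen_pair ::
  "(real^'d) set \<Rightarrow> (real^'d \<Rightarrow> real) set \<Rightarrow> ((real^'d \<Rightarrow> real) \<Rightarrow> ennreal) \<Rightarrow>
   (real \<Rightarrow> (real^'d \<Rightarrow> real) \<Rightarrow> (real^'d \<Rightarrow> real)) \<Rightarrow>
   (real^'d \<Rightarrow> real) \<Rightarrow> (real^'d \<Rightarrow> real) \<Rightarrow> bool" where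
  "gen_pair X F N E f g \<longleftrightarrow> f \<in> F \<and> g \<in> F \<and>
     (\<forall>t\<ge>0. (\<forall>x\<in>X. (\<lambda>s. E s g x) absolutely_integrable_on {0..t} \<and>
                     E t f x = f x + integral {0..t} (\<lambda>s. E s g x)) \<and>
             N (E t (\<lambda>x. \<bar>g x\<bar>)) < \<infinity>)"

definition gen_dom where
  "gen_dom X F N E = {f \<in> F. \<exists>g. gen_pair X F N E f g}"

text \<open>Only meaningful when \<open>g\<close> is determined by \<open>f\<close>; see \<open>gen_well_defined\<close>.\<close>

definition ext_gen where
  "ext_gen X F N E f = (THE g. gen_pair X F N E f g)"

text \<open>
  The axioms of a semigroup do not make the witness \<open>g\<close> unique: if \<open>E\<^sub>0\<close> is the identity and
  \<open>E\<^sub>t = 0\<close> for \<open>t > 0\<close>, then every \<open>g\<close> is a witness for \<open>f = 0\<close>. Writing \<open>B f := g\<close> presupposes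
  that it is.
\<close>

definition gen_well_defined where
  "gen_well_defined X F N E \<longleftrightarrow>
     (\<forall>f g g'. gen_pair X F N E f g \<longrightarrow> gen_pair X F N E f g' \<longrightarrow> g = g')"

text \<open>Starting from power 0 with domain \<open>F\<close>; the domain of power 1 is then \<^const>\<open>gen_dom\<close>.\<close>

primrec gen_pow_dom where
  "gen_pow_dom X F N E 0 = F"
| "gen_pow_dom X F N E (Suc m) =
     {f \<in> gen_pow_dom X F N E m. (ext_gen X F N E ^^ m) f \<in> gen_dom X F N E}"

text \<open>
  \<open>iterated_integral n h t\<close> is the \<open>n\<close>-fold integral of \<open>h t\<^sub>n\<close> over
  \<open>0 \<le> t\<^sub>n \<le> \<dots> \<le> t\<^sub>1 \<le> t\<close>, with \<open>t\<^sub>1\<close> the outermost variable.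
\<close>

primrec iterated_integral :: "nat \<Rightarrow> (real \<Rightarrow> real) \<Rightarrow> real \<Rightarrow> real" where
  "iterated_integral 0 h t = h t"
| "iterated_integral (Suc n) h t = integral {0..t} (iterated_integral n h)"

end

theory Submission imports Defs begin

text \<open>
  The semigroup property shifts the integral equation defining the generator, so the witness of
  \<open>E\<^sub>s f\<close> is \<open>E\<^sub>s\<close> applied to the witness of \<open>f\<close>; hence \<open>E\<^sub>s\<close> preserves the domains of the powers
  and \<open>B\<^sup>m E\<^sub>s f = E\<^sub>s B\<^sup>m f\<close>. The functions \<open>s \<mapsto> B\<^sup>m E\<^sub>s f x\<close> therefore are each
  the indefinite integral of the next one, and the expansion is Taylor's formula with the
  remainder in iterated integral form.
\<close>

text \<open>Only the innermost level rests on the assumption about \<open>h\<close>: every further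
  level is an indefinite integral, hence continuous on a compact interval.\<close>

lemma iterated_integral_absolutely_integrable:
  assumes "h absolutely_integrable_on {0..t}"
  shows "iterated_integral k h absolutely_integrable_on {0..t}"
proof (induction k)
  case 0
  have "iterated_integral 0 h = h" by (simp add: fun_eq_iff)
  then show ?case using assms by simp
next
  case (Suc k)
  have "continuous_on {0..t} (iterated_integral (Suc k) h)"
    using indefinite_integral_continuous_1[OF set_lebesgue_integral_eq_integral(1)[OF Suc.IH]]
    by simp
  then show ?case by (rule absolutely_integrable_continuous_real)
qed

text \<open>With the factorial built in, integration merely raises \<open>k\<close> by one; both the
  remainder bound and the Taylor sum advance by this rule.\<close>

lemma has_integral_monomial:
  fixes s :: real
  assumes "0 \<le> s"
  shows "((\<lambda>r. c * r ^ k / fact k) has_integral c * s ^ Suc k / fact (Suc k)) {0..s}"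
proof -
  have "((\<lambda>r. c * r ^ k / fact k) has_integral
      c * s ^ Suc k / fact (Suc k) - c * 0 ^ Suc k / fact (Suc k)) {0..s}"
  proof (rule fundamental_theorem_of_calculus[OF assms])
    fix r :: real
    have "((\<lambda>r. c * r ^ Suc k / fact (Suc k)) has_real_derivative
        c * (real (Suc k) * r ^ k) / fact (Suc k)) (at r within {0..s})"
      by (auto intro!: derivative_eq_intros simp del: fact_Suc power_Suc)
    also have "c * (real (Suc k) * r ^ k) / fact (Suc k) = c * r ^ k / fact k"
      by (simp add: divide_simps del: of_nat_Suc)
    finally show "((\<lambda>r. c * r ^ Suc k / fact (Suc k)) has_vector_derivative c * r ^ k / fact k)
        (at r within {0..s})"
      by (simp add: has_real_derivative_iff_has_vector_derivative del: fact_Suc)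
  qed
  then show ?thesis by simp
qed

lemma abs_iterated_integral_le:
  assumes h: "h absolutely_integrable_on {0..t}"
    and C: "\<And>s. s \<in> {0..t} \<Longrightarrow> \<bar>h s\<bar> \<le> C"
    and "s \<in> {0..t}"
  shows "\<bar>iterated_integral k h s\<bar> \<le> C * s ^ k / fact k"
  using \<open>s \<in> {0..t}\<close>
proof (induction k arbitrary: s)
  case 0
  then show ?case using C by simp
next
  case (Suc k)
  have sub: "{0..s} \<subseteq> {0..t}" and s: "0 \<le> s" using Suc.prems by auto
  have int: "iterated_integral k h integrable_on {0..s}"
    using iterated_integral_absolutely_integrable[OF h] integrable_on_subinterval[OF _ sub]
    by (auto simp: absolutely_integrable_on_def)
  have "norm (integral {0..s} (iterated_integral k h))
      \<le> integral {0..s} (\<lambda>r. C * r ^ k / fact k)"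
    using sub Suc.IH
    by (intro integral_norm_bound_integral int has_integral_integrable[OF has_integral_monomial[OF s]])
      auto
  then show ?case
    using integral_unique[OF has_integral_monomial[OF s, of C k]] by simp
qed

text \<open>Integral equations take the place of derivatives. The induction drops the first
  function: the shifted families \<open>a (Suc m)\<close> and \<open>c (Suc m)\<close> give an
  expansion of \<open>a 1\<close> on all of \<open>{0..s}\<close>, and integrating it and adding
  \<open>c 0\<close> expands \<open>a 0\<close>.\<close>

lemma taylor_iterated_integral:
  fixes a :: "nat \<Rightarrow> real \<Rightarrow> real"
  assumes "\<And>m. m < n \<Longrightarrow> a (Suc m) absolutely_integrable_on {0..t}"
    and "\<And>m s. m < n \<Longrightarrow> s \<in> {0..t} \<Longrightarrow> a m s = c m + integral {0..s} (a (Suc m))"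
    and "s \<in> {0..t}"
  shows "a 0 s = (\<Sum>m<n. s ^ m / fact m * c m) + iterated_integral n (a n) s"
  using assms
proof (induction n arbitrary: a c s)
  case 0
  then show ?case by simp
next
  case (Suc n)
  have sub: "{0..s} \<subseteq> {0..t}" and s: "0 \<le> s" using Suc.prems(3) by auto
  let ?I = "iterated_integral n (a (Suc n))"
  have int: "?I integrable_on {0..s}"
    using iterated_integral_absolutely_integrable[OF Suc.prems(1)[of n]]
      integrable_on_subinterval[OF _ sub]
    by (auto simp: absolutely_integrable_on_def)
  have IH: "a 1 r = (\<Sum>m<n. c (Suc m) * r ^ m / fact m) + ?I r" if "r \<in> {0..s}" for r
  proof -
    have "a (Suc 0) r = (\<Sum>m<n. r ^ m / fact m * c (Suc m)) + iterated_integral n (a (Suc n)) r"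
      using Suc.IH[of "\<lambda>m. a (Suc m)" "\<lambda>m. c (Suc m)" r] Suc.prems(1,2) that sub by auto
    then show ?thesis by (simp add: mult.commute)
  qed
  have "((\<lambda>r. (\<Sum>m<n. c (Suc m) * r ^ m / fact m) + ?I r) has_integral
      (\<Sum>m<n. c (Suc m) * s ^ Suc m / fact (Suc m)) + integral {0..s} ?I) {0..s}"
    by (intro has_integral_add has_integral_sum has_integral_monomial s integrable_integral int) auto
  then have "(a 1 has_integral
      (\<Sum>m<n. c (Suc m) * s ^ Suc m / fact (Suc m)) + integral {0..s} ?I) {0..s}"
    using IH by (subst has_integral_cong) auto
  then have "a 0 s = c 0 + ((\<Sum>m<n. c (Suc m) * s ^ Suc m / fact (Suc m)) + integral {0..s} ?I)"
    using Suc.prems(2)[of 0 s] Suc.prems(3) by (simp add: integral_unique del: fact_Suc)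
  then show ?case
    by (simp add: sum.lessThan_Suc_shift mult.commute del: fact_Suc sum.lessThan_Suc)
qed

lemma ext_gen_eq:
  assumes "gen_well_defined X F N E" "gen_pair X F N E f g"
  shows "ext_gen X F N E f = g"
  using assms unfolding ext_gen_def gen_well_defined_def by (intro the_equality) auto

context operator_semigroup
begin

text \<open>Split the integral of the orbit of \<open>g\<close> over \<open>{0..s + t}\<close> at
  \<open>s\<close>. The first piece together with \<open>f x\<close> is \<open>E s f x\<close>; the
  second, translated by \<open>s\<close>, is the integral of the orbit of
  \<open>E s g\<close>.\<close>

lemma gen_pair_semigroup:
  assumes p: "gen_pair X F N E f g" and s: "0 \<le> s"
  shows "gen_pair X F N E (E s f) (E s g)"
  unfolding gen_pair_def
proof (intro conjI allI impI ballI)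
  have f: "f \<in> F" and g: "g \<in> F" using p by (auto simp: gen_pair_def)
  show "E s f \<in> F" "E s g \<in> F" using E_mem s f g by auto
  fix t :: real
  assume t: "0 \<le> t"
  \<comment> \<open>\<open>F\<close> is closed under \<open>E s\<close>, absolute values and
    \<open>E t\<close>, and all its members have finite norm.\<close>
  show "N (E t (\<lambda>x. \<bar>E s g x\<bar>)) < \<infinity>"
    using E_mem abs_mem norm_finite s t g by simp
  fix x
  assume x: "x \<in> X"
  let ?G = "\<lambda>r. E r g x"
  have st: "s \<le> s + t" "0 \<le> s + t" using s t by auto
  have G: "?G absolutely_integrable_on {0..s + t}"
    using p st x by (auto simp: gen_pair_def)
  have eq: "E r (E s g) x = ?G (r + s)" if "r \<in> {0..t}" for r
    using E_plus[of r s g] that s g by simp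
  have "?G absolutely_integrable_on {s..s + t}"
    by (rule absolutely_integrable_on_subinterval[OF G]) (use s in auto)
  then have int: "?G integrable_on {s..s + t}" "(\<lambda>r. \<bar>?G r\<bar>) integrable_on {s..s + t}"
    by (auto simp: absolutely_integrable_on_def)
  have integral_shift: "integral {0..t} (\<lambda>r. ?G (r + s)) = integral {s..s + t} ?G"
    using integral_shift_real_ivl[of s s "s + t" ?G] by (simp add: add.commute)
  have "(\<lambda>r. ?G (r + s)) absolutely_integrable_on {0..t}"
    using integrable_shift_real_ivl[OF int(1), of s] integrable_shift_real_ivl[OF int(2), of s]
    by (simp add: absolutely_integrable_on_def add.commute)
  then show "(\<lambda>r. E r (E s g) x) absolutely_integrable_on {0..t}"
    using eq by (subst set_integrable_cong[OF refl refl]) auto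
  have "E t (E s f) x = f x + integral {0..s + t} ?G"
    using E_plus[OF t s f, unfolded add.commute[of t s]] p st(2) x
    unfolding gen_pair_def by metis
  also have "integral {0..s + t} ?G = integral {0..s} ?G + integral {s..s + t} ?G"
    using G s st
    by (intro Henstock_Kurzweil_Integration.integral_combine[symmetric])
      (auto simp: absolutely_integrable_on_def)
  also have "integral {s..s + t} ?G = integral {0..t} (\<lambda>r. E r (E s g) x)"
    unfolding integral_shift[symmetric] using eq by (intro integral_cong) auto
  finally show "E t (E s f) x = E s f x + integral {0..t} (\<lambda>r. E r (E s g) x)"
    using p s x by (simp add: gen_pair_def)
qed

lemma gen_pair_ext_gen:
  assumes "gen_well_defined X F N E" "f \<in> gen_dom X F N E"
  shows "gen_pair X F N E f (ext_gen X F N E f)"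
  using assms ext_gen_eq[OF assms(1)] by (auto simp: gen_dom_def)

lemma gen_pow_dom_gen_pair:
  assumes "gen_well_defined X F N E" "f \<in> gen_pow_dom X F N E n" "m < n"
  shows "gen_pair X F N E ((ext_gen X F N E ^^ m) f) ((ext_gen X F N E ^^ Suc m) f)"
  using assms(2,3)
proof (induction n)
  case (Suc n)
  then show ?case using gen_pair_ext_gen[OF assms(1)] by (cases "m = n") auto
qed simp

text \<open>The two claims are proved together: membership at \<open>Suc n\<close> concerns the
  \<open>n\<close>-th power at \<open>E s f\<close>, which the commutation at \<open>n\<close>
  rewrites as \<open>E s\<close> of the \<open>n\<close>-th power at \<open>f\<close>. The witness
  is then shifted by \<open>gen_pair_semigroup\<close>, and uniqueness identifies it with the value
  of \<open>ext_gen\<close>.\<close>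

lemma gen_pow_semigroup:
  assumes wd: "gen_well_defined X F N E" and "f \<in> gen_pow_dom X F N E n" and s: "0 \<le> s"
  shows "E s f \<in> gen_pow_dom X F N E n
    \<and> (ext_gen X F N E ^^ n) (E s f) = E s ((ext_gen X F N E ^^ n) f)"
  using assms(2)
proof (induction n)
  case 0
  then show ?case using E_mem s by simp
next
  case (Suc n)
  have "gen_pair X F N E ((ext_gen X F N E ^^ n) (E s f)) (E s ((ext_gen X F N E ^^ Suc n) f))"
    using gen_pair_semigroup[OF gen_pow_dom_gen_pair[OF wd Suc.prems lessI] s] Suc by simp
  then show ?case
    using Suc ext_gen_eq[OF wd] by (auto simp: gen_dom_def gen_pair_def)
qed

lemma gen_pow_dom_mono:
  assumes "f \<in> gen_pow_dom X F N E n" "m \<le> n"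
  shows "f \<in> gen_pow_dom X F N E m"
  using assms by (induction n) (auto simp: le_Suc_eq)

end

text \<open>Since \<open>ext_gen\<close> and \<open>integral\<close> are total, the first two
  conjuncts certify that the powers at \<open>u s\<close> and all the nested integrals are genuine.
  The supremum is an \<open>ereal\<close> because \<open>h\<close> is only known to be integrable
  and may be unbounded.\<close>

theorem theorem4p4:
  fixes X :: "(real^'d) set"
    and F :: "(real^'d \<Rightarrow> real) set"
    and N :: "(real^'d \<Rightarrow> real) \<Rightarrow> ennreal"
    and E :: "real \<Rightarrow> (real^'d \<Rightarrow> real) \<Rightarrow> (real^'d \<Rightarrow> real)"
    and M :: nat and f :: "real^'d \<Rightarrow> real" and t :: real and x :: "real^'d"
  assumes "operator_semigroup X F N E"
    and "gen_well_defined X F N E"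
    and "M \<ge> 1"
    and "f \<in> gen_pow_dom X F N E (M + 1)"
    and "t \<ge> 0"
    and "x \<in> X"
  shows "let B = ext_gen X F N E;
             u = (\<lambda>s. E s f);
             uhat = (\<lambda>s y. \<Sum>m=0..M. s ^ m / fact m * (B ^^ m) f y);
             h = (\<lambda>s. (B ^^ (M + 1)) (u s) x)
         in (\<forall>s\<in>{0..t}. u s \<in> gen_pow_dom X F N E (M + 1)) \<and>
            (\<forall>k\<le>M. iterated_integral k h absolutely_integrable_on {0..t}) \<and>
            \<bar>u t x - uhat t x\<bar> = \<bar>iterated_integral (M + 1) h t\<bar> \<and>
            ereal \<bar>iterated_integral (M + 1) h t\<bar>
              \<le> ereal (t ^ (M + 1) / fact (M + 1)) * (SUP s\<in>{0..t}. ereal \<bar>h s\<bar>)"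
proof -
  interpret operator_semigroup X F N E by fact
  note wd = assms(2) and f = assms(4) and t = assms(5) and x = assms(6)
  define B where "B = ext_gen X F N E"
  \<comment> \<open>\<open>a m\<close> acts as the \<open>m\<close>-th time derivative of
    \<open>E s f x\<close>; its value at 0 is the Taylor coefficient.\<close>
  define a where "a m s = (B ^^ m) (E s f) x" for m s
  have a_eq: "a m s = E s ((B ^^ m) f) x" if "m \<le> M + 1" "0 \<le> s" for m s
    using gen_pow_semigroup[OF wd gen_pow_dom_mono[OF f that(1)] that(2)]
    by (simp add: a_def B_def)
  have pair: "gen_pair X F N E ((B ^^ m) f) ((B ^^ Suc m) f)" if "m < M + 1" for m
    using gen_pow_dom_gen_pair[OF wd f that] by (simp add: B_def)
  have a_int: "a (Suc m) absolutely_integrable_on {0..t}" if m: "m < M + 1" for m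
  proof -
    have "(\<lambda>s. E s ((B ^^ Suc m) f) x) absolutely_integrable_on {0..t}"
      using pair[OF m] t x unfolding gen_pair_def by blast
    \<comment> \<open>Commutation is available for nonnegative times only, so the two integrands are
      compared on the interval.\<close>
    moreover have "a (Suc m) s = E s ((B ^^ Suc m) f) x" if "s \<in> {0..t}" for s
      using a_eq[of "Suc m" s] m that by auto
    ultimately show ?thesis by (subst set_integrable_cong[OF refl refl]) auto
  qed
  have a_step: "a m s = (B ^^ m) f x + integral {0..s} (a (Suc m))"
    if m: "m < M + 1" and s: "s \<in> {0..t}" for m s
  proof -
    have "a m s = (B ^^ m) f x + integral {0..s} (\<lambda>r. E r ((B ^^ Suc m) f) x)"
      using pair[OF m] x s m a_eq[of m s] unfolding gen_pair_def by auto
    also have "integral {0..s} (\<lambda>r. E r ((B ^^ Suc m) f) x) = integral {0..s} (a (Suc m))"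
      using m a_eq[of "Suc m"] by (intro integral_cong) auto
    finally show ?thesis .
  qed
  let ?h = "a (M + 1)"
  let ?I = "iterated_integral (M + 1) ?h t"
  have h: "?h absolutely_integrable_on {0..t}" using a_int[of M] by simp
  have "a 0 t = (\<Sum>m<M + 1. t ^ m / fact m * (B ^^ m) f x) + ?I"
    by (rule taylor_iterated_integral) (use a_int a_step t in auto)
  then have taylor: "\<bar>E t f x - (\<Sum>m=0..M. t ^ m / fact m * (B ^^ m) f x)\<bar> = \<bar>?I\<bar>"
    by (simp add: a_def atLeast0AtMost lessThan_Suc_atMost del: sum.lessThan_Suc)
  have dom: "\<forall>s\<in>{0..t}. E s f \<in> gen_pow_dom X F N E (M + 1)"
    using gen_pow_semigroup[OF wd f] by auto
  define S where "S = (SUP s\<in>{0..t}. ereal \<bar>?h s\<bar>)"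
  have S: "ereal \<bar>?h s\<bar> \<le> S" if "s \<in> {0..t}" for s
    unfolding S_def using that by (rule SUP_upper)
  have bound: "ereal \<bar>?I\<bar> \<le> ereal (t ^ (M + 1) / fact (M + 1)) * S"
  proof (cases S)
    case (real C)
    have "\<bar>?I\<bar> \<le> C * t ^ (M + 1) / fact (M + 1)"
      by (rule abs_iterated_integral_le[OF h]) (use S real t in auto)
    then show ?thesis using real by (simp add: mult.commute del: fact_Suc)
  next
    case PInf
    show ?thesis
    \<comment> \<open>A positive factor keeps the bound infinite. At \<open>t = 0\<close> both sides
      vanish, as 0 times infinity is 0 in \<open>ereal\<close>.\<close>
    proof (cases "t = 0")
      case False
      then have "0 < t ^ (M + 1) / fact (M + 1)" using t by simp
      then show ?thesis using PInf by simp
    qed (simp add: zero_ereal_def[symmetric])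
  next
    \<comment> \<open>Impossible, because 0 lies in \<open>{0..t}\<close> and so \<open>S\<close> is
      at least the nonnegative value there.\<close>
    case MInf
    then show ?thesis using S[of 0] t by simp
  qed
  have "\<forall>k\<le>M. iterated_integral k ?h absolutely_integrable_on {0..t}"
    using iterated_integral_absolutely_integrable[OF h] by blast
  then show ?thesis
    using dom taylor bound unfolding Let_def S_def a_def B_def by blast
qed

end
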